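(* Let $G$ be a signed ribbon graph, let $E'\subseteq E(G)$ be any subset of its edges, and let $G':=G^{E'}$ be the dual of $G$ with respect to $E'$. Then the restriction of the polynomial $x^{k(G)}y^{v(G)}z^{v(G)+1}R_G(x,y,z)$ to the surface $xyz^2=1$ is invariant under this generalized duality, i.e. $$x^{k(G)} y^{v(G)} z^{v(G)+1} R_G(x,y,z)\Big|_{xyz^2=1} = x^{k(G')} y^{v(G')} z^{v(G')+1} R_{G'}(x,y,z)\Big|_{xyz^2=1},$$ where $R$ denotes the signed Bollobás–Riordan polynomial. (If half-integer exponents occur, restriction to $xyz^2=1$ is understood as restriction to $x^{1/2}y^{1/2}z=1$.)
   Context: **Ribbon graphs.** A ribbon graph $G$ is a (possibly non-orientable) surface with boundary, represented as the union of two finite sets of closed topological discs, vertices $V(G)$ and edges $E(G)$, such that: vertices and edges intersect in disjoint line segments; each such segment lies on the boundary of precisely one vertex and precisely one edge; every edge contains exactly two such segments. Ribbon graphs are considered up to homeomorphism preserving the decomposition into vertices and edges. $G$ is signed if it comes with a sign function $\varepsilon: E(G)\to\{\pm1\}$ (homeomorphisms preserve signs). **Arrow presentation.** Equivalently, a ribbon graph is a collection of disjoint oriented circles (one per vertex) carrying labeled arrows, each label occurring exactly twice, modulo: reversing all arrows on a circle together with the cyclic order of arrows along it; reversing both arrows with the same label. To recover the surface, fill each circle with a vertex-disc and, for each label $e$, attach a rectangle (the edge $e$) along a pair of opposite sides to the two arrows labeled $e$, so that both arrows are coherent with one orientation of the boundary of the rectangle. **Generalized dual.** For $E'\subseteq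 E(G)$ the signed ribbon graph $G^{E'}$ is defined as follows. Let $F_{E'}$ be the spanning subgraph of $G$ with all vertices of $G$ and only the edges of $E'$. The circles (vertices) of $G^{E'}$ are the boundary components of the surface $F_{E'}$. The edges of $G^{E'}$ are the same discs as those of $G$: an edge $e\notin E'$ gives the same pair of arrows as in $G$ (these lie on the boundary of $F_{E'}$); an edge $e\in E'$, viewed as a rectangle attached in $G$ to vertex-discs by two opposite sides, now gives the arrows on its other pair of opposite sides (which lie on the boundary of $F_{E'}$), directed by an orientation of the boundary of the rectangle. In particular $E(G^{E'})$ is identified with $E(G)$. Signs: $\varepsilon_{G^{E'}}(e)=-\varepsilon_G(e)$ for $e\in E'$ and $\varepsilon_{G^{E'}}(e)=\varepsilon_G(e)$ for $e\notin E'$. **Parameters.** $v(G)=|V(G)|$, $e(G)=|E(G)|$, $k(G)$ is the number of connected components, $r(G)=v(G)-k(G)$, $n(G)=e(G)-r(G)$, and $f(G)$ is the number of connected components of the boundary of the surface $G$. $\mathcal F(G)$ is the set of spanning subgraphs of $G$ (all vertices of $G$ and a subset of the edges). For $F\in\mathcal F(G)$, $\overline F$ is the spanning subgraph with exactly the edges of $G$ not in $F$, $e_-(F)$ is the number of negative edges of $F$, and $s(F)=\frac{e_-(F)-e_-(\overline F)}{2}$. **Signed Bollobás–Riordan polynomial.** $$R_G(x,y,z):=\sum_{F\in\mathcal F(G)} x^{r(G)-r(F)+s(F)}\,y^{n(F)-s(F)}\,z^{k(F)-f(F)+n(F)},$$ a Laurent polynomial in $x^{1/2},y^{1/2},z$.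 *)

theory Defs
  imports Complex_Main
begin

text \<open>
  Signed ribbon graphs are given by arrow presentations. The two arrows with label \<open>e\<close> are
  \<open>(e, False)\<close> and \<open>(e, True)\<close>. Gluing the rectangle of \<open>e\<close> along its two arrows turns the tails
  and heads of these arrows into the four corners of the rectangle. As both arrows agree with one
  orientation of its boundary, that boundary runs through the corners in the cyclic order
  \<open>(e, False, Tail), (e, False, Head), (e, True, Tail), (e, True, Head)\<close>.
\<close>

datatype tip = Tail | Head

type_synonym 'e corner = "'e \<times> bool \<times> tip"

text \<open>
  The circles are recorded without their orientations, so reversing a circle (that is, its cyclic
  order together with the arrows on it) does not change the record. The field \<open>arc\<close> gives the cyclic
  arrangement of the arrows: removing the arrows from a circle leaves open arcs, and \<open>arc\<close> exchanges
  the two ends of each of them. A circle carrying arrows is thus a cycle that alternates between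
  arrows and arcs. The circles without arrows (isolated vertices) are the elements of \<open>bare\<close>.
\<close>

record ('v, 'e) signed_arrows =
  edges :: "'e set"
  arc :: "'e corner \<Rightarrow> 'e corner"
  bare :: "'v set"
  sign :: "'e \<Rightarrow> int"

definition corners :: "('v, 'e, 'z) signed_arrows_scheme \<Rightarrow> 'e corner set" where
  "corners G = edges G \<times> UNIV"

definition signed_ribbon_graph :: "('v, 'e, 'z) signed_arrows_scheme \<Rightarrow> bool" where
  "signed_ribbon_graph G \<longleftrightarrow>
     finite (edges G) \<and> finite (bare G) \<and>
     (\<forall>c\<in>corners G. arc G c \<in> corners G \<and> arc G c \<noteq> c \<and> arc G (arc G c) = c) \<and>
     (\<forall>e\<in>edges G. sign G e = 1 \<or> sign G e = -1)"

text \<open>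
  The other end of the side of the rectangle that starts at a given corner: along the arrow
  (a segment shared with a vertex-disc), or along the free side of the rectangle.
\<close>

fun along_arrow :: "'e corner \<Rightarrow> 'e corner" where
  "along_arrow (e, i, Tail) = (e, i, Head)"
| "along_arrow (e, i, Head) = (e, i, Tail)"

fun along_side :: "'e corner \<Rightarrow> 'e corner" where
  "along_side (e, i, Head) = (e, \<not> i, Tail)"
| "along_side (e, i, Tail) = (e, \<not> i, Head)"

text \<open>
  The closed curves made of arcs and of the pieces joining \<open>c\<close> to \<open>j c\<close>, each given by the set of
  corners on it. The relation is symmetric because \<open>arc G\<close> and all maps \<open>j\<close> used below are
  involutions on the corners.
\<close>

definition curves :: "('v, 'e, 'z) signed_arrows_scheme \<Rightarrow> ('e corner \<Rightarrow> 'e corner) \<Rightarrow> 'e corner set set" where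
  "curves G j = corners G //
     {(c, d). c \<in> corners G \<and> d \<in> corners G \<and>
       (c, d) \<in> ({(a, arc G a) | a. a \<in> corners G} \<union> {(a, j a) | a. a \<in> corners G})\<^sup>*}"

definition verts :: "('v, 'e, 'z) signed_arrows_scheme \<Rightarrow> ('e corner set + 'v) set" where
  "verts G = curves G along_arrow <+> bare G"

text \<open>
  A spanning subgraph is given by its set \<open>F\<close> of edges. Its boundary runs along the arcs and along
  the free sides of the edges in \<open>F\<close>; at an edge outside \<open>F\<close> it follows the arrow, since this
  segment of the vertex-disc is not covered by an edge of \<open>F\<close>.
\<close>

definition along_boundary :: "'e set \<Rightarrow> 'e corner \<Rightarrow> 'e corner" where
  "along_boundary F c = (if fst c \<in> F then along_side c else along_arrow c)"

definition boundary_components ::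
    "('v, 'e, 'z) signed_arrows_scheme \<Rightarrow> 'e set \<Rightarrow> ('e corner set + 'v) set" where
  "boundary_components G F = curves G (along_boundary F) <+> bare G"

definition adjacency :: "('v, 'e, 'z) signed_arrows_scheme \<Rightarrow> 'e set \<Rightarrow> ('e corner set + 'v) rel" where
  "adjacency G F = {(Inl C, Inl D) | C D.
     C \<in> curves G along_arrow \<and> D \<in> curves G along_arrow \<and>
     (\<exists>e\<in>F. \<exists>i. (e, i, Tail) \<in> C \<and> (e, \<not> i, Tail) \<in> D)}"

definition components ::
    "('v, 'e, 'z) signed_arrows_scheme \<Rightarrow> 'e set \<Rightarrow> ('e corner set + 'v) set set" where
  "components G F = verts G //
     {(u, v). u \<in> verts G \<and> v \<in> verts G \<and> (u, v) \<in> (adjacency G F)\<^sup>*}"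

text \<open>
  The parameters of the spanning subgraph with edge set \<open>F\<close>; those of \<open>G\<close> itself are obtained
  for \<open>F = edges G\<close>.
\<close>

definition num_verts :: "('v, 'e, 'z) signed_arrows_scheme \<Rightarrow> nat" where
  "num_verts G = card (verts G)"

definition num_comps :: "('v, 'e, 'z) signed_arrows_scheme \<Rightarrow> 'e set \<Rightarrow> nat" where
  "num_comps G F = card (components G F)"

definition num_bdry :: "('v, 'e, 'z) signed_arrows_scheme \<Rightarrow> 'e set \<Rightarrow> nat" where
  "num_bdry G F = card (boundary_components G F)"

definition rank :: "('v, 'e, 'z) signed_arrows_scheme \<Rightarrow> 'e set \<Rightarrow> int" where
  "rank G F = int (num_verts G) - int (num_comps G F)"

definition nullity :: "('v, 'e, 'z) signed_arrows_scheme \<Rightarrow> 'e set \<Rightarrow> int" where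
  "nullity G F = int (card F) - rank G F"

definition num_neg :: "('v, 'e, 'z) signed_arrows_scheme \<Rightarrow> 'e set \<Rightarrow> nat" where
  "num_neg G F = card {e \<in> F. sign G e = -1}"

definition twice_s :: "('v, 'e, 'z) signed_arrows_scheme \<Rightarrow> 'e set \<Rightarrow> int" where
  "twice_s G F = int (num_neg G F) - int (num_neg G (edges G - F))"

text \<open>
  The signed Bollobas-Riordan polynomial as a Laurent polynomial function of
  \<open>sx = x\<^bsup>1/2\<^esup>\<close>, \<open>sy = y\<^bsup>1/2\<^esup>\<close> and \<open>z\<close>: the exponents of \<open>x\<close> and \<open>y\<close> are doubled.
\<close>

definition BR :: "('v, 'e, 'z) signed_arrows_scheme \<Rightarrow> 'a::field \<Rightarrow> 'a \<Rightarrow> 'a \<Rightarrow> 'a" where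
  "BR G sx sy z = (\<Sum>F\<in>Pow (edges G).
      sx powi (2 * (rank G (edges G) - rank G F) + twice_s G F)
    * sy powi (2 * nullity G F - twice_s G F)
    * z powi (int (num_comps G F) - int (num_bdry G F) + nullity G F))"

text \<open>
  For the dual with respect to \<open>A\<close>, the new arrows of \<open>e \<in> A\<close> are the free sides of the old
  rectangle, directed by the boundary orientation above: the arrow \<open>(e, i)\<close> now leads from the old
  corner \<open>(e, i, Head)\<close> to the old corner \<open>(e, \<not> i, Tail)\<close>. So \<open>old_corner A c\<close> is the old name of
  the corner that is called \<open>c\<close> in the dual. Points on the circles and arcs between arrows do not
  move, only the names of the corners change. The opposite orientation of the rectangle would
  reverse both arrows labelled \<open>e\<close>, which gives the same ribbon graph.
\<close>

fun quarter_turn :: "'e corner \<Rightarrow> 'e corner" where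
  "quarter_turn (e, i, Tail) = (e, i, Head)"
| "quarter_turn (e, i, Head) = (e, \<not> i, Tail)"

fun quarter_turn_back :: "'e corner \<Rightarrow> 'e corner" where
  "quarter_turn_back (e, i, Head) = (e, i, Tail)"
| "quarter_turn_back (e, i, Tail) = (e, \<not> i, Head)"

definition old_corner :: "'e set \<Rightarrow> 'e corner \<Rightarrow> 'e corner" where
  "old_corner A c = (if fst c \<in> A then quarter_turn c else c)"

definition new_corner :: "'e set \<Rightarrow> 'e corner \<Rightarrow> 'e corner" where
  "new_corner A c = (if fst c \<in> A then quarter_turn_back c else c)"

definition gen_dual :: "('v, 'e) signed_arrows \<Rightarrow> 'e set \<Rightarrow> ('v, 'e) signed_arrows" where
  "gen_dual G A =
     \<lparr> edges = edges G,
       arc = (\<lambda>c. new_corner A (arc G (old_corner A c))),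
       bare = bare G,
       sign = (\<lambda>e. if e \<in> A then - sign G e else sign G e) \<rparr>"

lemma fst_corner [simp]:
  "fst (quarter_turn c) = fst c" "fst (quarter_turn_back c) = fst c"
  "fst (old_corner A c) = fst c" "fst (new_corner A c) = fst c"
  "fst (along_boundary A c) = fst c" "fst (along_arrow c) = fst c"
proof -
  obtain e i t where c: "c = (e, i, t)" by (cases c) auto
  show "fst (quarter_turn c) = fst c" "fst (quarter_turn_back c) = fst c"
    "fst (old_corner A c) = fst c" "fst (new_corner A c) = fst c"
    "fst (along_boundary A c) = fst c" "fst (along_arrow c) = fst c"
    by (cases t; simp add: c old_corner_def new_corner_def along_boundary_def)+
qed

lemma old_new_corner [simp]:
  "old_corner A (new_corner A c) = c" "new_corner A (old_corner A c) = c"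
proof -
  obtain e i t where c: "c = (e, i, t)" by (cases c) auto
  show "old_corner A (new_corner A c) = c" "new_corner A (old_corner A c) = c"
    by (cases t; simp add: c old_corner_def new_corner_def)+
qed

lemma corners_iff: "c \<in> corners G \<longleftrightarrow> fst c \<in> edges G"
  by (cases c) (simp add: corners_def)

lemma signed_ribbon_graph_gen_dual:
  assumes "signed_ribbon_graph G"
  shows "signed_ribbon_graph (gen_dual G A)"
proof -
  let ?H = "gen_dual G A"
  have "arc ?H c \<in> corners ?H \<and> arc ?H c \<noteq> c \<and> arc ?H (arc ?H c) = c" if "c \<in> corners ?H" for c
  proof -
    have "old_corner A c \<in> corners G"
      using that by (simp add: corners_iff gen_dual_def)
    then have *: "arc G (old_corner A c) \<in> corners G" "arc G (old_corner A c) \<noteq> old_corner A c"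
      "arc G (arc G (old_corner A c)) = old_corner A c"
      using assms by (simp_all add: signed_ribbon_graph_def)
    then have "new_corner A (arc G (old_corner A c)) \<noteq> c"
      by (metis old_new_corner(1))
    with * show ?thesis by (simp add: corners_iff gen_dual_def)
  qed
  moreover have "\<forall>e\<in>edges ?H. sign ?H e = 1 \<or> sign ?H e = -1"
    using assms by (auto simp: signed_ribbon_graph_def gen_dual_def)
  ultimately show ?thesis
    using assms by (simp add: signed_ribbon_graph_def gen_dual_def)
qed

lemma old_corner_along_arrow:
  "old_corner A (along_arrow c) = along_boundary A (old_corner A c)"
proof -
  obtain e i t where c: "c = (e, i, t)" by (cases c) auto
  show ?thesis by (cases t; simp add: c old_corner_def along_boundary_def)
qed

lemma quotient_eq_image: "B // T = (\<lambda>c. T `` {c}) ` B"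
  unfolding quotient_def by blast

text \<open>The vertices of the dual are the boundary components of the spanning subgraph.\<close>

lemma curves_gen_dual:
  "(`) (old_corner A) ` curves (gen_dual G A) along_arrow = curves G (along_boundary A)"
proof -
  let ?f = "old_corner A" and ?H = "gen_dual G A"
  define R where "R = {(a, arc ?H a) | a. a \<in> corners ?H} \<union> {(a, along_arrow a) | a. a \<in> corners ?H}"
  define S where "S = {(a, arc G a) | a. a \<in> corners G} \<union> {(a, along_boundary A a) | a. a \<in> corners G}"
  have cor: "c \<in> corners ?H \<longleftrightarrow> ?f c \<in> corners G" for c
    by (simp add: corners_iff gen_dual_def)
  have RS: "(c, d) \<in> R \<longleftrightarrow> (?f c, ?f d) \<in> S" for c d
  proof -
    have "d = arc ?H c \<longleftrightarrow> ?f d = arc G (?f c)"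
      unfolding gen_dual_def by simp (metis old_new_corner)
    moreover have "d = along_arrow c \<longleftrightarrow> ?f d = along_boundary A (?f c)"
      by (metis old_corner_along_arrow old_new_corner(2))
    moreover have "(c, d) \<in> R \<longleftrightarrow> c \<in> corners ?H \<and> (d = arc ?H c \<or> d = along_arrow c)"
      unfolding R_def by blast
    moreover have "(?f c, ?f d) \<in> S \<longleftrightarrow>
        ?f c \<in> corners G \<and> (?f d = arc G (?f c) \<or> ?f d = along_boundary A (?f c))"
      unfolding S_def by blast
    ultimately show ?thesis using cor by simp
  qed
  have "(c, d) \<in> R\<^sup>* \<Longrightarrow> (?f c, ?f d) \<in> S\<^sup>*" for c d
    by (induction rule: rtrancl_induct) (simp, metis RS rtrancl_into_rtrancl)
  moreover have "(c, d) \<in> S\<^sup>* \<Longrightarrow> (new_corner A c, new_corner A d) \<in> R\<^sup>*" for c d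
    by (induction rule: rtrancl_induct) (simp, metis RS old_new_corner(1) rtrancl_into_rtrancl)
  ultimately have star: "(c, d) \<in> R\<^sup>* \<longleftrightarrow> (?f c, ?f d) \<in> S\<^sup>*" for c d
    by (metis old_new_corner(2))
  let ?R = "{(c, d). c \<in> corners ?H \<and> d \<in> corners ?H \<and> (c, d) \<in> R\<^sup>*}"
  let ?S = "{(c, d). c \<in> corners G \<and> d \<in> corners G \<and> (c, d) \<in> S\<^sup>*}"
  have cls: "?f ` (?R `` {c}) = ?S `` {?f c}" for c
  proof (intro set_eqI iffI)
    fix d assume "d \<in> ?S `` {?f c}"
    then have "new_corner A d \<in> ?R `` {c}" by (simp add: cor star)
    then have "?f (new_corner A d) \<in> ?f ` (?R `` {c})" by (rule imageI)
    then show "d \<in> ?f ` (?R `` {c})" unfolding old_new_corner .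
  next
    fix d assume "d \<in> ?f ` (?R `` {c})"
    then obtain d' where "d = ?f d'" "d' \<in> ?R `` {c}" by (rule imageE)
    then show "d \<in> ?S `` {?f c}" by (simp add: cor star)
  qed
  have img: "?f ` corners ?H = corners G"
  proof (intro set_eqI iffI)
    fix d assume "d \<in> corners G"
    then have "new_corner A d \<in> corners ?H" by (simp add: cor)
    then have "?f (new_corner A d) \<in> ?f ` corners ?H" by (rule imageI)
    then show "d \<in> ?f ` corners ?H" unfolding old_new_corner .
  next
    fix d assume "d \<in> ?f ` corners ?H"
    then obtain d' where "d = ?f d'" "d' \<in> corners ?H" by (rule imageE)
    then show "d \<in> corners G" by (simp add: cor)
  qed
  have "(`) ?f ` (corners ?H // ?R) = (\<lambda>c. ?S `` {?f c}) ` corners ?H"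
    unfolding quotient_eq_image image_image cls ..
  also have "\<dots> = (\<lambda>c. ?S `` {c}) ` (?f ` corners ?H)" by (simp only: image_image)
  also have "\<dots> = corners G // ?S" unfolding quotient_eq_image img ..
  finally show ?thesis unfolding curves_def R_def S_def .
qed

end

theory Submission
  imports Defs
begin

text \<open>
  After multiplication by \<open>x\<^bsup>k(G)\<^esup> y\<^bsup>v(G)\<^esup> z\<^bsup>v(G)+1\<^esup>\<close> the numbers \<open>v(G)\<close> and \<open>k(G)\<close> cancel from the
  term of \<open>F\<close>, and \<open>k(F)\<close> enters only through \<open>(xyz\<^sup>2)\<^bsup>k(F)\<^esup> = 1\<close>. With \<open>x\<^bsup>1/2\<^esup> = (y\<^bsup>1/2\<^esup>z)\<^bsup>-1\<^esup>\<close> the term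
  becomes \<open>y\<^bsup>m\<^esup> z\<^bsup>1+m-f(F)\<^esup>\<close>, where \<open>m = |F| - 2 s(F)\<close> counts the edges that are positive in
  \<open>F\<close> or negative outside of \<open>F\<close>. The symmetric difference with \<open>E'\<close> is a bijection from the
  spanning subgraphs of \<open>G\<close> to those of the dual. It preserves \<open>m\<close> because the signs on \<open>E'\<close> are
  reversed, and \<open>f\<close> because the boundary curves of corresponding subgraphs coincide: on \<open>E'\<close>,
  duality exchanges the arrows with the free sides.
\<close>

lemma rtrancl_conj_bij:
  assumes "bij f" and RS: "\<And>c d. (c, d) \<in> R \<longleftrightarrow> (f c, f d) \<in> S"
  shows "(c, d) \<in> R\<^sup>* \<longleftrightarrow> (f c, f d) \<in> S\<^sup>*"
proof
  show "(f c, f d) \<in> S\<^sup>*" if "(c, d) \<in> R\<^sup>*"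
    using that by induction (auto simp: RS intro: rtrancl_into_rtrancl)
  \<comment> \<open>Surjectivity of \<open>f\<close> provides a preimage for every intermediate
    point of an \<open>S\<close>-path, so the whole path pulls back.\<close>
  have "(inv f a, inv f b) \<in> R\<^sup>*" if "(a, b) \<in> S\<^sup>*" for a b
    using that
    by induction (auto simp: RS bij_is_surj[OF \<open>bij f\<close>] surj_f_inv_f intro: rtrancl_into_rtrancl)
  from this[of "f c" "f d"] show "(c, d) \<in> R\<^sup>*" if "(f c, f d) \<in> S\<^sup>*"
    using that by (simp add: bij_is_inj[OF \<open>bij f\<close>])
qed

text \<open>Since \<open>f\<close> intertwines both kinds of pieces, it transports the generating
  relation in both directions and hence maps classes onto classes. Leaving \<open>j\<close> and
  \<open>j'\<close> free covers the boundary of every spanning subgraph, not only the vertices of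
  the dual.\<close>

lemma curves_image_bij:
  assumes "bij f"
    and cor: "\<And>c. c \<in> corners H \<longleftrightarrow> f c \<in> corners G"
    and arc: "\<And>c. f (arc H c) = arc G (f c)"
    and j: "\<And>c. f (j c) = j' (f c)"
  shows "(`) f ` curves H j = curves G j'"
proof -
  define R where "R = {(a, arc H a) | a. a \<in> corners H} \<union> {(a, j a) | a. a \<in> corners H}"
  define S where "S = {(a, arc G a) | a. a \<in> corners G} \<union> {(a, j' a) | a. a \<in> corners G}"
  have eq: "f a = f b \<longleftrightarrow> a = b" for a b
    using bij_is_inj[OF \<open>bij f\<close>] by (simp add: inj_eq)
  have "(c, d) \<in> R \<longleftrightarrow> (f c, f d) \<in> S" for c d
  proof -
    have "(c, d) \<in> R \<longleftrightarrow> c \<in> corners H \<and> (f d = f (arc H c) \<or> f d = f (j c))"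
      unfolding R_def eq by blast
    moreover have "(f c, f d) \<in> S \<longleftrightarrow> f c \<in> corners G \<and> (f d = arc G (f c) \<or> f d = j' (f c))"
      unfolding S_def by blast
    ultimately show ?thesis by (simp add: cor arc j)
  qed
  then have star: "(c, d) \<in> R\<^sup>* \<longleftrightarrow> (f c, f d) \<in> S\<^sup>*" for c d
    by (rule rtrancl_conj_bij[OF \<open>bij f\<close>])
  let ?R = "{(c, d). c \<in> corners H \<and> d \<in> corners H \<and> (c, d) \<in> R\<^sup>*}"
  let ?S = "{(c, d). c \<in> corners G \<and> d \<in> corners G \<and> (c, d) \<in> S\<^sup>*}"
  have surj: "\<exists>c. d = f c" for d
    using bij_is_surj[OF \<open>bij f\<close>] by (rule surjE) blast
  have cls: "f ` (?R `` {c}) = ?S `` {f c}" for c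
  proof (intro set_eqI iffI)
    fix d assume "d \<in> ?S `` {f c}"
    with surj[of d] show "d \<in> f ` (?R `` {c})" by (auto simp: cor star)
  qed (auto simp: cor star)
  have img: "f ` corners H = corners G"
    using surj cor by (metis imageI image_subsetI subsetI subset_antisym)
  have "(`) f ` (corners H // ?R) = (\<lambda>c. ?S `` {c}) ` (f ` corners H)"
    unfolding quotient_eq_image image_image cls ..
  also have "\<dots> = corners G // ?S"
    unfolding quotient_eq_image img ..
  finally show ?thesis
    unfolding curves_def R_def S_def .
qed

text \<open>Lets the cardinality of boundary components split into curves and bare circles.\<close>

lemma finite_curves:
  assumes "finite (edges G)"
  shows "finite (curves G j)"
proof -
  have "finite (UNIV :: tip set)"
    by (rule finite_subset[of _ "{Tail, Head}"]) (use tip.exhaust in auto)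
  with assms have "finite (corners G)"
    unfolding corners_def by (simp add: finite_cartesian_product finite_Prod_UNIV)
  then show ?thesis
    unfolding curves_def quotient_eq_image by simp
qed

lemma bij_old_corner: "bij (old_corner A)"
  by (rule bij_betw_byWitness[where f' = "new_corner A"]) auto

text \<open>For an edge in \<open>A\<close> the quarter turn swaps the two pairs of opposite sides
  of its rectangle, and toggling its membership in \<open>F\<close> compensates for this. Other
  edges are untouched.\<close>

lemma old_corner_along_boundary:
  "old_corner A (along_boundary (sym_diff F A) c) = along_boundary F (old_corner A c)"
proof -
  obtain e i t where c: "c = (e, i, t)" by (cases c) auto
  show ?thesis by (cases t) (auto simp: c old_corner_def along_boundary_def)
qed

lemma num_bdry_gen_dual:
  assumes "signed_ribbon_graph G"
  shows "num_bdry (gen_dual G A) (sym_diff F A) = num_bdry G F"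
proof -
  let ?H = "gen_dual G A"
  have "(`) (old_corner A) ` curves ?H (along_boundary (sym_diff F A)) = curves G (along_boundary F)"
    by (rule curves_image_bij)
      (auto simp: bij_old_corner old_corner_along_boundary corners_iff, auto simp: gen_dual_def)
  moreover have "inj ((`) (old_corner A))"
    by (rule injI) (simp add: inj_image_eq_iff bij_is_inj[OF bij_old_corner])
  ultimately have "card (curves ?H (along_boundary (sym_diff F A))) = card (curves G (along_boundary F))"
    by (metis card_image inj_on_subset subset_UNIV)
  moreover have "finite (edges G)" "finite (bare G)" "edges ?H = edges G" "bare ?H = bare G"
    using assms by (simp_all add: signed_ribbon_graph_def gen_dual_def)
  ultimately show ?thesis
    unfolding num_bdry_def boundary_components_def by (simp add: card_Plus finite_curves)
qed

text \<open>With \<open>?P\<close>, \<open>?N\<close>, \<open>?M\<close> denoting cardinalities, |F|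
  = P + N and 2s(F) = N - M, so the difference is P + M.\<close>

lemma card_minus_twice_s:
  assumes "signed_ribbon_graph G" and "F \<subseteq> edges G"
  shows "int (card F) - twice_s G F = int (card {e \<in> edges G. e \<in> F \<longleftrightarrow> sign G e = 1})"
proof -
  let ?P = "{e \<in> F. sign G e = 1}" and ?N = "{e \<in> F. sign G e = -1}"
    and ?M = "{e \<in> edges G - F. sign G e = -1}"
  have fin: "finite (edges G)" and sgn: "\<And>e. e \<in> edges G \<Longrightarrow> sign G e = 1 \<or> sign G e = -1"
    using assms(1) by (auto simp: signed_ribbon_graph_def)
  have fF: "finite F" using fin assms(2) by (rule rev_finite_subset)
  have "F = ?P \<union> ?N" using sgn assms(2) by auto
  then have "card F = card (?P \<union> ?N)" by simp
  also have "\<dots> = card ?P + card ?N" using fF by (intro card_Un_disjoint) auto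
  finally have 1: "card F = card ?P + card ?N" .
  have "{e \<in> edges G. e \<in> F \<longleftrightarrow> sign G e = 1} = ?P \<union> ?M" using sgn assms(2) by fastforce
  also have "card \<dots> = card ?P + card ?M" using fin fF by (intro card_Un_disjoint) auto
  finally show ?thesis using 1 by (simp add: twice_s_def num_neg_def)
qed

lemma card_minus_twice_s_gen_dual:
  assumes "signed_ribbon_graph G" and "A \<subseteq> edges G" and "F \<subseteq> edges G"
  shows "int (card (sym_diff F A)) - twice_s (gen_dual G A) (sym_diff F A)
    = int (card F) - twice_s G F"
proof -
  let ?H = "gen_dual G A"
  have ed: "edges ?H = edges G" by (simp add: gen_dual_def)
  \<comment> \<open>On \<open>A\<close> both sides of the inner equivalence are negated; off
    \<open>A\<close> neither changes.\<close>
  have "{e \<in> edges ?H. e \<in> sym_diff F A \<longleftrightarrow> sign ?H e = 1} = {e \<in> edges G. e \<in> F \<longleftrightarrow> sign G e = 1}"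
    using assms(1) by (auto simp: gen_dual_def signed_ribbon_graph_def)
  then show ?thesis
    using assms by (subst (1 2) card_minus_twice_s) (auto simp: signed_ribbon_graph_gen_dual ed)
qed

lemma BR_normalized:
  fixes sx sy z :: "'a::field"
  assumes "sx * sy * z = 1"
  shows "(sx\<^sup>2) ^ num_comps G (edges G) * (sy\<^sup>2) ^ num_verts G * z ^ (num_verts G + 1) * BR G sx sy z
    = (\<Sum>F\<in>Pow (edges G). sy powi (2 * (int (card F) - twice_s G F))
        * z powi (1 + (int (card F) - twice_s G F) - int (num_bdry G F)))"
proof -
  \<comment> \<open>Exponents may be negative, so merging powers of one base relies on that base
    being nonzero.\<close>
  have nz: "sx \<noteq> 0" "sy \<noteq> 0" "z \<noteq> 0" using assms by auto
  have sx: "sx = inverse (sy * z)"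
    using assms nz by (simp add: field_simps)
  show ?thesis
    unfolding BR_def sum_distrib_left
  proof (rule sum.cong[OF refl])
    fix F
    define k v kF t n f where "k = int (num_comps G (edges G))" and "v = int (num_verts G)"
      and "kF = int (num_comps G F)" and "t = twice_s G F" and "n = int (card F)"
      and "f = int (num_bdry G F)"
    note defs = k_def[symmetric] v_def[symmetric] kF_def[symmetric] t_def[symmetric]
      n_def[symmetric] f_def[symmetric]
    have "(sx\<^sup>2) ^ num_comps G (edges G) = sx powi (2 * k)"
      "(sy\<^sup>2) ^ num_verts G = sy powi (2 * v)" "z ^ (num_verts G + 1) = z powi (v + 1)"
      unfolding k_def v_def by (simp_all add: power_int_mult power_int_add nz)
    then have "(sx\<^sup>2) ^ num_comps G (edges G) * (sy\<^sup>2) ^ num_verts G * z ^ (num_verts G + 1) *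
        (sx powi (2 * (rank G (edges G) - rank G F) + twice_s G F)
        * sy powi (2 * nullity G F - twice_s G F)
        * z powi (int (num_comps G F) - int (num_bdry G F) + nullity G F))
      = (sx powi (2 * k) * sx powi (2 * (kF - k) + t))
        * (sy powi (2 * v) * sy powi (2 * (n - v + kF) - t))
        * (z powi (v + 1) * z powi (kF - f + (n - v + kF)))"
      unfolding rank_def nullity_def by (simp add: defs algebra_simps)
    \<comment> \<open>Here \<open>k\<close> and \<open>v\<close> cancel against the normalizing
      factor.\<close>
    also have "\<dots> = sx powi (2 * kF + t) * sy powi (2 * n + 2 * kF - t) * z powi (1 + 2 * kF - f + n)"
      using nz by (simp add: algebra_simps flip: power_int_add)
    also have "sx powi (2 * kF + t) = sy powi (- (2 * kF + t)) * z powi (- (2 * kF + t))"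
      unfolding sx
      by (simp only: power_int_inverse power_int_minus power_int_mult_distrib inverse_mult_distrib)
    also have "sy powi (- (2 * kF + t)) * z powi (- (2 * kF + t))
        * sy powi (2 * n + 2 * kF - t) * z powi (1 + 2 * kF - f + n)
      = (sy powi (- (2 * kF + t)) * sy powi (2 * n + 2 * kF - t))
        * (z powi (- (2 * kF + t)) * z powi (1 + 2 * kF - f + n))"
      by (simp only: ac_simps)
    \<comment> \<open>Eliminating \<open>sx\<close> has produced -2kF in both exponents, which
      removes the last trace of the components of \<open>F\<close>.\<close>
    also have "\<dots> = sy powi (2 * (n - t)) * z powi (1 + (n - t) - f)"
      using nz by (simp add: algebra_simps flip: power_int_add)
    finally show "(sx\<^sup>2) ^ num_comps G (edges G) * (sy\<^sup>2) ^ num_verts G * z ^ (num_verts G + 1) *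
        (sx powi (2 * (rank G (edges G) - rank G F) + twice_s G F)
        * sy powi (2 * nullity G F - twice_s G F)
        * z powi (int (num_comps G F) - int (num_bdry G F) + nullity G F))
      = sy powi (2 * (int (card F) - twice_s G F))
        * z powi (1 + (int (card F) - twice_s G F) - int (num_bdry G F))"
      by (simp only: defs)
  qed
qed

theorem theorem3p1:
  fixes G G' :: "('v, 'e) signed_arrows" and E' :: "'e set" and sx sy z :: "'a::field"
  assumes "signed_ribbon_graph G"
    and "E' \<subseteq> edges G"
    and "G' = gen_dual G E'"
    and "sx * sy * z = 1"
  shows "(sx\<^sup>2) ^ num_comps G (edges G) * (sy\<^sup>2) ^ num_verts G * z ^ (num_verts G + 1) * BR G sx sy z
       = (sx\<^sup>2) ^ num_comps G' (edges G') * (sy\<^sup>2) ^ num_verts G' * z ^ (num_verts G' + 1) * BR G' sx sy z"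
  unfolding BR_normalized[OF assms(4)]
\<comment> \<open>Symmetric difference with \<open>E'\<close> is an involution, so the same map
  serves in both directions.\<close>
proof (rule sum.reindex_bij_witness[where i = "\<lambda>F. sym_diff F E'" and j = "\<lambda>F. sym_diff F E'"])
  fix F assume "F \<in> Pow (edges G)"
  then show "sy powi (2 * (int (card (sym_diff F E')) - twice_s G' (sym_diff F E')))
      * z powi (1 + (int (card (sym_diff F E')) - twice_s G' (sym_diff F E'))
        - int (num_bdry G' (sym_diff F E')))
    = sy powi (2 * (int (card F) - twice_s G F))
      * z powi (1 + (int (card F) - twice_s G F) - int (num_bdry G F))"
    unfolding assms(3)
    by (simp only: Pow_iff card_minus_twice_s_gen_dual[OF assms(1,2)] num_bdry_gen_dual[OF assms(1)])
qed (use assms(2,3) in \<open>auto simp: gen_dual_def\<close>)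

end
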